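(* Let $V$ be a free $\mathbf{k}$-module with a $\mathbf{k}$-basis $W$, and let $\Pi$ be a simple terminating term-rewriting system on $V$ with respect to $W$. Suppose $\leq$ is a well-order on $W$ that is compatible with $\Pi$. Then $\Pi$ is confluent if and only if every $w\in W$ is locally confluent.
   Context: $\mathbf{k}$ is a fixed (commutative, unital) domain and $\mathbf{k}^\times=\mathbf{k}\setminus\{0\}$. Let $V$ be a free $\mathbf{k}$-module with basis $W$. For $f\in V$, $\mathrm{Supp}(f)\subseteq W$ is the set of basis elements with nonzero coefficient in $f$ ($\mathrm{Supp}(0)=\emptyset$). For $w\in\mathrm{Supp}(f)$ with coefficient $c_w$, put $R_w(f):=c_w w-f$, so $f=c_w w-R_w(f)$ with $w\notin\mathrm{Supp}(R_w(f))$. A term-rewriting system on $V$ with respect to $W$ is a subset $\Pi\subseteq W\times V$; its elements $(t,v)$ are written $t\to v$ and called rewriting rules. $\Pi$ is simple if $t\notin\mathrm{Supp}(v)$ for every $t\to v\in\Pi$. One-step rewriting: for $f,g\in V$, $f\to_\Pi g$ means that there is a rule $t\to v\in\Pi$ with $t\in\mathrm{Supp}(f)$, with coefficient $c_t\in\mathbf{k}^\times$, such that $g=c_t v-R_t(f)$ (i.e. the term $c_t t$ of $f$ is replaced by $c_t v$). $\overset{*}{\to}_\Pi$ is the reflexive-transitive closure of $\to_\Pi$ on $V$. $f,g\in V$ are joinable, $f\downarrow_\Pi g$, if there is $h\in V$ with $f\overset{*}{\to}_\Pi h$ and $g\overset{*}{\to}_\Pi h$. $\Pi$ is terminating if there is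 no infinite chain $f_0\to_\Pi f_1\to_\Pi f_2\to_\Pi\cdots$. An element $f\in V$ is locally confluent if for all $g,h\in V$ with $f\to_\Pi g$ and $f\to_\Pi h$ one has $g\downarrow_\Pi h$. An element $f\in V$ is confluent if for all $g,h\in V$ with $f\overset{*}{\to}_\Pi g$ and $f\overset{*}{\to}_\Pi h$ one has $g\downarrow_\Pi h$. $\Pi$ is confluent if every $f\in V$ is confluent. $\Pi$ is compatible with a linear order $\leq$ on $W$ if $\overline{v}<t$ for each $t\to v\in\Pi$, where $\overline{v}$ is the largest element of $\mathrm{Supp}(v)$; that is, every element of $\mathrm{Supp}(v)$ is $<t$ (a vacuous condition if $v=0$). *)

theory Defs
  imports Complex_Main
begin

locale free_module = module scale
  for scale :: "'k::idom \<Rightarrow> 'v::ab_group_add \<Rightarrow> 'v" (infixr "*s" 75) +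
  fixes W :: "'v set"
  assumes independent_W: "independent W"
    and span_W: "span W = UNIV"
begin

definition coeff :: "'v \<Rightarrow> 'v \<Rightarrow> 'k" where
  "coeff f w = representation W f w"

definition Supp :: "'v \<Rightarrow> 'v set" where
  "Supp f = {w \<in> W. coeff f w \<noteq> 0}"

definition remainder :: "'v \<Rightarrow> 'v \<Rightarrow> 'v" where
  "remainder w f = coeff f w *s w - f"

text \<open>A pair \<open>(t, v)\<close> in a system encodes the rewriting rule \<open>t \<rightarrow> v\<close>.\<close>

definition rewriting_system :: "('v \<times> 'v) set \<Rightarrow> bool" where
  "rewriting_system \<Pi> \<longleftrightarrow> \<Pi> \<subseteq> W \<times> UNIV"

definition simple :: "('v \<times> 'v) set \<Rightarrow> bool" where
  "simple \<Pi> \<longleftrightarrow> (\<forall>(t, v) \<in> \<Pi>. t \<notin> Supp v)"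

definition step :: "('v \<times> 'v) set \<Rightarrow> 'v \<Rightarrow> 'v \<Rightarrow> bool" where
  "step \<Pi> f g \<longleftrightarrow> (\<exists>(t, v) \<in> \<Pi>. t \<in> Supp f \<and> g = coeff f t *s v - remainder t f)"

definition joinable :: "('v \<times> 'v) set \<Rightarrow> 'v \<Rightarrow> 'v \<Rightarrow> bool" where
  "joinable \<Pi> f g \<longleftrightarrow> (\<exists>h. (step \<Pi>)\<^sup>*\<^sup>* f h \<and> (step \<Pi>)\<^sup>*\<^sup>* g h)"

definition terminating :: "('v \<times> 'v) set \<Rightarrow> bool" where
  "terminating \<Pi> \<longleftrightarrow> \<not> (\<exists>f :: nat \<Rightarrow> 'v. \<forall>n. step \<Pi> (f n) (f (Suc n)))"

definition locally_confluent_at :: "('v \<times> 'v) set \<Rightarrow> 'v \<Rightarrow> bool" where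
  "locally_confluent_at \<Pi> f \<longleftrightarrow>
    (\<forall>g h. step \<Pi> f g \<longrightarrow> step \<Pi> f h \<longrightarrow> joinable \<Pi> g h)"

definition confluent_at :: "('v \<times> 'v) set \<Rightarrow> 'v \<Rightarrow> bool" where
  "confluent_at \<Pi> f \<longleftrightarrow>
    (\<forall>g h. (step \<Pi>)\<^sup>*\<^sup>* f g \<longrightarrow> (step \<Pi>)\<^sup>*\<^sup>* f h \<longrightarrow> joinable \<Pi> g h)"

definition confluent :: "('v \<times> 'v) set \<Rightarrow> bool" where
  "confluent \<Pi> \<longleftrightarrow> (\<forall>f. confluent_at \<Pi> f)"

text \<open>
  The non-strict order on \<open>W\<close> is given by its graph \<open>r\<close>. Compatibility says that the largest
  element of \<open>Supp v\<close> is strictly below \<open>t\<close>; bounding all of \<open>Supp v\<close> includes the case \<open>v = 0\<close>,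
  where there is no largest element and the condition is void.
\<close>

definition compatible :: "('v \<times> 'v) set \<Rightarrow> ('v \<times> 'v) set \<Rightarrow> bool" where
  "compatible r \<Pi> \<longleftrightarrow> (\<forall>(t, v) \<in> \<Pi>. \<forall>s \<in> Supp v. (s, t) \<in> r \<and> s \<noteq> t)"

end

end

theory Submission
  imports Defs
begin

text \<open>
  Only one direction has content: assume that every basis element is locally confluent.

  The idea is to build a linear normal form map. Termination lets every basis element \<open>w\<close> be
  rewritten to some irreducible (\<open>normal\<close>) element; choose one, \<open>\<phi> w\<close>, and extend \<open>\<phi>\<close> linearly to a map
  \<open>\<Phi>\<close> on the whole module. This \<open>\<Phi>\<close> fixes irreducible elements (\<open>linear_extension_normal\<close>).
  Suppose that it is also invariant under rewriting. If \<open>f\<close> rewrites to \<open>g\<close> and to \<open>h\<close>, rewrite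
  \<open>g\<close> and \<open>h\<close> further to irreducible elements; both of these are their own value under \<open>\<Phi>\<close>, hence
  both equal \<open>\<Phi> f\<close>, so \<open>g\<close> and \<open>h\<close> are joinable. Thus confluence holds at all elements as soon as
  \<open>\<Phi>\<close> is invariant.

  Since \<open>\<Phi>\<close> is linear, invariance under one step only requires \<open>\<Phi> v = \<Phi> t\<close> for each rule
  \<open>t \<rightarrow> v\<close>. This is shown by well-founded induction on \<open>t\<close> (\<open>rule_invariant\<close>). By compatibility,
  any rewriting that starts at an element supported below \<open>t\<close> stays supported below \<open>t\<close> and hence
  uses only rules covered by the induction hypothesis. Let \<open>t \<rightarrow> u\<close> be the first step of the
  rewriting of \<open>t\<close> to \<open>\<phi> t\<close>. Then \<open>\<Phi> u = \<Phi> (\<phi> t) = \<phi> t = \<Phi> t\<close>. Local confluence at \<open>t\<close> joins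
  \<open>u\<close> with \<open>v\<close>, and both sides of the join take place below \<open>t\<close>, so \<open>\<Phi> v = \<Phi> u\<close>.
\<close>

context free_module
begin

section \<open>Coefficients and linear extension\<close>

lemma finite_Supp: "finite (Supp f)"
  by (rule finite_subset[OF _ finite_representation[of W f]]) (auto simp: Supp_def coeff_def)

lemma coeff_add: "coeff (f + g) w = coeff f w + coeff g w"
  by (simp add: coeff_def representation_add independent_W span_W)

lemma coeff_diff: "coeff (f - g) w = coeff f w - coeff g w"
  by (simp add: coeff_def representation_diff independent_W span_W)

lemma coeff_scale: "coeff (c *s f) w = c * coeff f w"
  by (simp add: coeff_def representation_scale independent_W span_W)

lemma coeff_basis: "t \<in> W \<Longrightarrow> coeff t w = (if w = t then 1 else 0)"
  by (simp add: coeff_def representation_basis independent_W)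

lemma Supp_basis: "t \<in> W \<Longrightarrow> Supp t = {t}"
  by (auto simp: Supp_def coeff_basis)

lemma sum_coeff_Supp: "(\<Sum>w\<in>Supp f. coeff f w *s w) = f"
proof -
  have "Supp f = {w. representation W f w \<noteq> 0}"
    using representation_ne_zero by (auto simp: Supp_def coeff_def)
  then show ?thesis
    using sum_nonzero_representation_eq[of W f] by (simp add: coeff_def independent_W span_W)
qed

definition linear_extension :: "('v \<Rightarrow> 'v) \<Rightarrow> 'v \<Rightarrow> 'v" where
  "linear_extension \<phi> f = (\<Sum>w\<in>Supp f. coeff f w *s \<phi> w)"

lemma linear_extension_superset:
  assumes "finite A" "Supp f \<subseteq> A" "A \<subseteq> W"
  shows "linear_extension \<phi> f = (\<Sum>w\<in>A. coeff f w *s \<phi> w)"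
  unfolding linear_extension_def using assms
  by (intro sum.mono_neutral_left) (auto simp: Supp_def)

lemma linear_extension_add:
  "linear_extension \<phi> (f + g) = linear_extension \<phi> f + linear_extension \<phi> g"
proof -
  let ?A = "Supp f \<union> Supp g"
  have A: "finite ?A" "?A \<subseteq> W" "Supp (f + g) \<subseteq> ?A"
    by (auto simp: finite_Supp) (auto simp: Supp_def coeff_add)
  show ?thesis
    using A by (simp add: linear_extension_superset[of ?A] coeff_add scale_left_distrib sum.distrib)
qed

lemma linear_extension_scale: "linear_extension \<phi> (c *s f) = c *s linear_extension \<phi> f"
proof -
  have "Supp (c *s f) \<subseteq> Supp f" "Supp f \<subseteq> W"
    by (auto simp: Supp_def coeff_scale)
  then show ?thesis
    by (simp add: linear_extension_superset[of "Supp f"] finite_Supp coeff_scale scale_sum_right)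
qed

lemma linear_extension_basis: "t \<in> W \<Longrightarrow> linear_extension \<phi> t = \<phi> t"
  by (simp add: linear_extension_def Supp_basis coeff_basis)

section \<open>Rewriting steps and irreducible elements\<close>

text \<open>
  The form \<open>f + c \<cdot> (v - t)\<close> of the result of a step is the one to which linear maps apply.
\<close>

lemma stepE:
  assumes "step \<Pi> f g"
  obtains t v where "(t, v) \<in> \<Pi>" "t \<in> Supp f" "g = f + coeff f t *s (v - t)"
  using assms by (auto simp: step_def remainder_def scale_right_diff_distrib algebra_simps)

lemma step_basis_iff:
  assumes "t \<in> W"
  shows "step \<Pi> t g \<longleftrightarrow> (t, g) \<in> \<Pi>"
  using assms by (auto simp: step_def remainder_def Supp_basis coeff_basis)

lemma linear_extension_step:
  assumes "step \<Pi> f g"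
    and rules: "\<And>t v. (t, v) \<in> \<Pi> \<Longrightarrow> t \<in> Supp f \<Longrightarrow> linear_extension \<phi> v = linear_extension \<phi> t"
  shows "linear_extension \<phi> g = linear_extension \<phi> f"
proof -
  obtain t v where tv: "(t, v) \<in> \<Pi>" "t \<in> Supp f" "g = f + coeff f t *s (v - t)"
    using assms(1) by (rule stepE)
  have "linear_extension \<phi> (v - t) + linear_extension \<phi> t = linear_extension \<phi> v"
    by (simp flip: linear_extension_add)
  then have "linear_extension \<phi> (v - t) = 0"
    using rules[OF tv(1,2)] by simp
  then show ?thesis
    by (simp add: tv(3) linear_extension_add linear_extension_scale)
qed

definition normal :: "('v \<times> 'v) set \<Rightarrow> 'v \<Rightarrow> bool" where
  "normal \<Pi> f \<longleftrightarrow> (\<forall>g. \<not> step \<Pi> f g)"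

lemma exists_normal_form:
  assumes "terminating \<Pi>"
  shows "\<exists>g. (step \<Pi>)\<^sup>*\<^sup>* f g \<and> normal \<Pi> g"
proof -
  have "wf {(g, f). step \<Pi> f g}"
    using assms by (simp add: wf_iff_no_infinite_down_chain terminating_def)
  then show ?thesis
  proof (induction f)
    case (less f)
    show ?case
    proof (cases "normal \<Pi> f")
      case False
      then obtain g where "step \<Pi> f g"
        by (auto simp: normal_def)
      then show ?thesis
        using less by (meson case_prodI converse_rtranclp_into_rtranclp mem_Collect_eq)
    qed blast
  qed
qed

lemma normal_Supp:
  assumes "normal \<Pi> f" "s \<in> Supp f"
  shows "normal \<Pi> s"
  unfolding normal_def
proof (intro allI notI)
  fix g
  assume "step \<Pi> s g"
  then have "(s, g) \<in> \<Pi>"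
    using assms(2) by (simp add: step_basis_iff Supp_def)
  then have "step \<Pi> f (coeff f s *s g - remainder s f)"
    using assms(2) unfolding step_def by blast
  then show False
    using assms(1) by (simp add: normal_def)
qed

text \<open>
  By \<open>normal_Supp\<close> each \<open>s\<close> in the support of \<open>f\<close> is irreducible, so the only rewriting that starts
  at \<open>s\<close> is the empty one and \<open>\<phi> s = s\<close>. The linear extension then returns the basis expansion of
  \<open>f\<close>.
\<close>

lemma linear_extension_normal:
  assumes \<phi>: "\<And>w. w \<in> W \<Longrightarrow> (step \<Pi>)\<^sup>*\<^sup>* w (\<phi> w)" and "normal \<Pi> f"
  shows "linear_extension \<phi> f = f"
proof -
  have "\<phi> s = s" if "s \<in> Supp f" for s
  proof -
    have "(step \<Pi>)\<^sup>*\<^sup>* s (\<phi> s)"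
      using that \<phi> by (simp add: Supp_def)
    then show ?thesis
      using normal_Supp[OF assms(2) that] by (cases rule: converse_rtranclpE) (auto simp: normal_def)
  qed
  then have "linear_extension \<phi> f = (\<Sum>w\<in>Supp f. coeff f w *s w)"
    by (simp add: linear_extension_def)
  then show ?thesis
    by (simp add: sum_coeff_Supp)
qed

section \<open>Rewriting below a basis element\<close>

definition supported_below :: "('v \<times> 'v) set \<Rightarrow> 'v \<Rightarrow> 'v \<Rightarrow> bool" where
  "supported_below r t f \<longleftrightarrow> (\<forall>s \<in> Supp f. (s, t) \<in> r - Id)"

lemma supported_below_step:
  assumes "trans r" "antisym r" "compatible r \<Pi>"
    and "supported_below r t f" "step \<Pi> f g"
  shows "supported_below r t g"
proof -
  obtain u v where uv: "(u, v) \<in> \<Pi>" "u \<in> Supp f" "g = f + coeff f u *s (v - u)"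
    using assms(5) by (rule stepE)
  have "Supp g \<subseteq> Supp f \<union> Supp v"
    using uv(2) coeff_basis[of u]
    by (auto simp: Supp_def uv(3) coeff_add coeff_scale coeff_diff split: if_splits)
  moreover have "(s, t) \<in> r - Id" if "s \<in> Supp v" for s
  proof -
    have "(s, u) \<in> r - Id" "(u, t) \<in> r - Id"
      using assms(3,4) uv(1,2) that by (auto simp: compatible_def supported_below_def)
    then show ?thesis
      using assms(1,2) by (meson transD trans_diff_Id)
  qed
  ultimately show ?thesis
    using assms(4) by (auto simp: supported_below_def)
qed

text \<open>
  The induction must carry the support bound along the rewriting, because it is what makes the
  hypothesis on the rules applicable to the next step.
\<close>

lemma linear_extension_steps_below:
  assumes "trans r" "antisym r" "compatible r \<Pi>"
    and rules: "\<And>u v. (u, v) \<in> \<Pi> \<Longrightarrow> (u, t) \<in> r - Id \<Longrightarrow>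
      linear_extension \<phi> v = linear_extension \<phi> u"
    and "(step \<Pi>)\<^sup>*\<^sup>* f g" "supported_below r t f"
  shows "linear_extension \<phi> g = linear_extension \<phi> f"
proof -
  have "supported_below r t g \<and> linear_extension \<phi> g = linear_extension \<phi> f"
    using assms(5)
  proof induction
    case base
    then show ?case
      using assms(6) by simp
  next
    case (step g h)
    have below: "supported_below r t g"
      using step.IH by blast
    have "linear_extension \<phi> h = linear_extension \<phi> g"
      using step.hyps(2)
    proof (rule linear_extension_step)
      fix u v
      assume "(u, v) \<in> \<Pi>" "u \<in> Supp g"
      then show "linear_extension \<phi> v = linear_extension \<phi> u"
        using below rules by (auto simp: supported_below_def)
    qed
    with step.IH show ?case
      using supported_below_step[OF assms(1-3) below step.hyps(2)] by simp
  qed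
  then show ?thesis ..
qed

text \<open>
  This is where local confluence at basis elements enters: it compares the given rule \<open>t \<rightarrow> v\<close> with
  the rule \<open>t \<rightarrow> u\<close> that starts the rewriting of \<open>t\<close> to the chosen normal form \<open>\<phi> t\<close>. Everything that
  happens after these two first steps lies below \<open>t\<close>, where \<open>linear_extension \<phi>\<close> is already known to
  be invariant.
\<close>

lemma rule_invariant:
  assumes "rewriting_system \<Pi>" "well_order_on W r" "compatible r \<Pi>"
    and local: "\<And>w. w \<in> W \<Longrightarrow> locally_confluent_at \<Pi> w"
    and \<phi>: "\<And>w. w \<in> W \<Longrightarrow> (step \<Pi>)\<^sup>*\<^sup>* w (\<phi> w) \<and> normal \<Pi> (\<phi> w)"
    and "(t, v) \<in> \<Pi>"
  shows "linear_extension \<phi> v = linear_extension \<phi> t"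
proof -
  have r: "trans r" "antisym r" "wf (r - Id)"
    using assms(2) by (auto simp: order_on_defs)
  from r(3) assms(6) show ?thesis
  proof (induction t arbitrary: v)
    case (less t)
    have below: "linear_extension \<phi> g = linear_extension \<phi> u"
      if "(t, u) \<in> \<Pi>" "(step \<Pi>)\<^sup>*\<^sup>* u g" for u g
    proof (rule linear_extension_steps_below[OF r(1,2) assms(3) _ that(2)])
      show "supported_below r t u"
        using assms(3) that(1) by (auto simp: compatible_def supported_below_def)
    qed (use less.IH in blast)
    have t: "t \<in> W"
      using assms(1) less.prems by (auto simp: rewriting_system_def)
    have "\<not> normal \<Pi> t"
      using less.prems t by (auto simp: normal_def step_basis_iff)
    then have "t \<noteq> \<phi> t"
      using \<phi>[OF t] by metis
    then obtain u where u: "step \<Pi> t u" "(step \<Pi>)\<^sup>*\<^sup>* u (\<phi> t)"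
      using \<phi>[OF t] by (metis converse_rtranclpE)
    have v: "step \<Pi> t v"
      using less.prems t by (simp add: step_basis_iff)
    have rules: "(t, u) \<in> \<Pi>"
      using u(1) t by (simp add: step_basis_iff)
    obtain h where h: "(step \<Pi>)\<^sup>*\<^sup>* u h" "(step \<Pi>)\<^sup>*\<^sup>* v h"
      using local[OF t] u(1) v by (auto simp: locally_confluent_at_def joinable_def)
    have "linear_extension \<phi> v = linear_extension \<phi> u"
      using below[OF rules h(1)] below[OF less.prems h(2)] by simp
    also have "\<dots> = linear_extension \<phi> (\<phi> t)"
      using below[OF rules u(2)] by simp
    also have "\<dots> = \<phi> t"
      using linear_extension_normal[of \<Pi> \<phi>] \<phi> t by blast
    also have "\<dots> = linear_extension \<phi> t"
      using t by (simp add: linear_extension_basis)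
    finally show ?case .
  qed
qed

section \<open>Confluence from local confluence at basis elements\<close>

lemma confluent_of_basis:
  assumes "rewriting_system \<Pi>" "terminating \<Pi>" "well_order_on W r" "compatible r \<Pi>"
    and local: "\<And>w. w \<in> W \<Longrightarrow> locally_confluent_at \<Pi> w"
  shows "confluent \<Pi>"
proof -
  obtain \<phi> where \<phi>: "\<And>w. (step \<Pi>)\<^sup>*\<^sup>* w (\<phi> w) \<and> normal \<Pi> (\<phi> w)"
    using exists_normal_form[OF assms(2)] by metis
  have invariant: "linear_extension \<phi> g = linear_extension \<phi> f" if "(step \<Pi>)\<^sup>*\<^sup>* f g" for f g
    using that
  proof induction
    case (step g h)
    have "linear_extension \<phi> h = linear_extension \<phi> g"
      using step.hyps(2) by (rule linear_extension_step)
        (rule rule_invariant[OF assms(1,3,4) local \<phi>])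
    with step.IH show ?case
      by simp
  qed simp
  have to_value: "(step \<Pi>)\<^sup>*\<^sup>* g (linear_extension \<phi> f)" if "(step \<Pi>)\<^sup>*\<^sup>* f g" for f g
  proof -
    obtain n where n: "(step \<Pi>)\<^sup>*\<^sup>* g n" "normal \<Pi> n"
      using exists_normal_form[OF assms(2)] by blast
    have "n = linear_extension \<phi> n"
      using linear_extension_normal[OF _ n(2), of \<phi>] \<phi> by simp
    also have "\<dots> = linear_extension \<phi> f"
      using that n(1) by (intro invariant) simp
    finally show ?thesis
      using n(1) by simp
  qed
  show ?thesis
    unfolding confluent_def confluent_at_def joinable_def using to_value by blast
qed

end

theorem theorem2p36:
  fixes scale :: "'k::idom \<Rightarrow> 'v::ab_group_add \<Rightarrow> 'v"
    and W :: "'v set"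
    and \<Pi> :: "('v \<times> 'v) set"
    and r :: "('v \<times> 'v) set"
  assumes "free_module scale W"
    and "free_module.rewriting_system W \<Pi>"
    and "free_module.simple scale W \<Pi>"
    and "free_module.terminating scale W \<Pi>"
    and "well_order_on W r"
    and "free_module.compatible scale W r \<Pi>"
  shows "free_module.confluent scale W \<Pi> \<longleftrightarrow>
    (\<forall>w \<in> W. free_module.locally_confluent_at scale W \<Pi> w)"
proof -
  interpret free_module scale W
    by (rule assms(1))
  show ?thesis
  proof
    assume "confluent \<Pi>"
    then show "\<forall>w \<in> W. locally_confluent_at \<Pi> w"
      unfolding confluent_def confluent_at_def locally_confluent_at_def by blast
  next
    assume "\<forall>w \<in> W. locally_confluent_at \<Pi> w"
    then show "confluent \<Pi>"
      using confluent_of_basis[OF assms(2,4,5,6)] by blast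
  qed
qed

end
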